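(* Let $t,r\geq 2$ be integers. If $n=R_t(rK_2)-1$, then $$\widetilde{R}_t(rK_2;n)=\binom n2\qquad\text{and}\qquad \widetilde{R}'_t(rK_2;n)\geq \Omega(n^2),$$ where the second assertion means that there is an absolute constant $c>0$ (not depending on $t$, $r$, $n$) such that $\widetilde{R}'_t(rK_2;n)\geq c\,n^2$ for all such $t,r,n$.
   Context: $rK_2$ denotes the matching with $r$ edges. $R_t(rK_2)$ is the least integer $n$ such that any $t$-coloring of $E(K_n)$ contains a monochromatic copy of $rK_2$. The games: in both games Builder repeatedly queries edges of $K_n$ (adaptively) and Painter reveals the color in $[t]=\{1,\dots,t\}$ of each queried edge according to a coloring of $E(K_n)$ hidden from Builder; queried edges are called exposed. After $\ell$ queries, let $C_1,\dots,C_t$ be the exposed color classes ($C_i$ = set of exposed edges of color $i$). Locating game: Painter may use any coloring $E(K_n)\to[t]$. Builder has won if either (1) for some $i\in[t]$, $C_i$ contains a copy of $rK_2$, or (2) every coloring $\chi:E(K_n)\to[t]$ with $C_i\subseteq\chi^{-1}(i)$ for all $i$ contains no monochromatic copy of $rK_2$ in any color. $\widetilde{R}_t(rK_2;n)$ is the smallest $\ell$ for which Builder can guarantee to win the locating game on $K_n$ with at most $\ell$ queries, regardless of Painter's strategy. Cornering game: call a coloring $\chi:E(K_n)\to[t]$ valid if it contains a monochromatic copy of $rK_2$ in some color. Painter is required to use a valid coloring. Builder has won if there is a fixed color $c\in[t]$ such that every valid coloring $\chi$ with $C_i\subseteq\chi^{-1}(i)$ for all $i\in[t]$ contains a copy of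 $rK_2$ in color $c$. $\widetilde{R}'_t(rK_2;n)$ is the smallest $\ell$ for which Builder can guarantee to win the cornering game on $K_n$ with at most $\ell$ queries, regardless of Painter's strategy. *)

theory Defs
  imports Complex_Main "HOL-Library.FuncSet" "HOL-Library.Ramsey"
begin

definition K_edges :: "nat \<Rightarrow> nat set set" where
  "K_edges n = nsets {..<n} 2"

text \<open>Colorings are constrained only on the edges of the complete graph; their values elsewhere
  are never inspected.\<close>

definition colorings :: "nat \<Rightarrow> nat \<Rightarrow> (nat set \<Rightarrow> nat) set" where
  "colorings t n = K_edges n \<rightarrow> {1..t}"

definition color_class :: "nat \<Rightarrow> (nat set \<Rightarrow> nat) \<Rightarrow> nat \<Rightarrow> nat set set" where
  "color_class n \<chi> i = {e \<in> K_edges n. \<chi> e = i}"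

definition contains_matching :: "nat \<Rightarrow> nat set set \<Rightarrow> bool" where
  "contains_matching r F \<longleftrightarrow> (\<exists>M\<subseteq>F. finite M \<and> card M = r \<and> pairwise disjnt M)"

definition has_mono_matching :: "nat \<Rightarrow> nat \<Rightarrow> nat \<Rightarrow> (nat set \<Rightarrow> nat) \<Rightarrow> bool" where
  "has_mono_matching t r n \<chi> \<longleftrightarrow> (\<exists>i\<in>{1..t}. contains_matching r (color_class n \<chi> i))"

definition matching_Ramsey :: "nat \<Rightarrow> nat \<Rightarrow> nat" where
  "matching_Ramsey t r = (LEAST n. \<forall>\<chi>\<in>colorings t n. has_mono_matching t r n \<chi>)"

text \<open>A history lists the queried edges with their revealed colors, and a strategy of Builder
  maps the history so far to the next query.\<close>

type_synonym history = "(nat set \<times> nat) list"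
type_synonym strategy = "history \<Rightarrow> nat set"

definition exposed :: "history \<Rightarrow> nat \<Rightarrow> nat set set" where
  "exposed h i = {e. (e, i) \<in> set h}"

definition compatible :: "nat \<Rightarrow> nat \<Rightarrow> history \<Rightarrow> (nat set \<Rightarrow> nat) \<Rightarrow> bool" where
  "compatible t n h \<chi> \<longleftrightarrow> (\<forall>i\<in>{1..t}. exposed h i \<subseteq> color_class n \<chi> i)"

fun play :: "strategy \<Rightarrow> (nat set \<Rightarrow> nat) \<Rightarrow> nat \<Rightarrow> history" where
  "play S \<chi> 0 = []"
| "play S \<chi> (Suc k) = (let h = play S \<chi> k; e = S h in h @ [(e, \<chi> e)])"

text \<open>Against every coloring Painter is allowed to hide, the strategy reaches a position in the
  winning set after at most \<open>l\<close> queries, all of them edges of the complete graph. Repeating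
  a query is permitted; it wastes a move. As Builder's strategy is deterministic, quantifying over
  the hidden coloring also covers a Painter who answers adaptively while remaining consistent with
  some allowed coloring.\<close>

definition guarantees_win ::
  "nat \<Rightarrow> (nat set \<Rightarrow> nat) set \<Rightarrow> (history \<Rightarrow> bool) \<Rightarrow> nat \<Rightarrow> strategy \<Rightarrow> bool" where
  "guarantees_win n allowed won l S \<longleftrightarrow>
     (\<forall>\<chi>\<in>allowed. \<exists>k\<le>l. (\<forall>j<k. S (play S \<chi> j) \<in> K_edges n) \<and> won (play S \<chi> k))"

definition locating_won :: "nat \<Rightarrow> nat \<Rightarrow> nat \<Rightarrow> history \<Rightarrow> bool" where
  "locating_won t r n h \<longleftrightarrow>
     (\<exists>i\<in>{1..t}. contains_matching r (exposed h i)) \<or>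
     (\<forall>\<chi>\<in>colorings t n. compatible t n h \<chi> \<longrightarrow> \<not> has_mono_matching t r n \<chi>)"

definition locating_number :: "nat \<Rightarrow> nat \<Rightarrow> nat \<Rightarrow> nat" where
  "locating_number t r n =
     (LEAST l. \<exists>S. guarantees_win n (colorings t n) (locating_won t r n) l S)"

definition valid_colorings :: "nat \<Rightarrow> nat \<Rightarrow> nat \<Rightarrow> (nat set \<Rightarrow> nat) set" where
  "valid_colorings t r n = {\<chi> \<in> colorings t n. has_mono_matching t r n \<chi>}"

definition cornering_won :: "nat \<Rightarrow> nat \<Rightarrow> nat \<Rightarrow> history \<Rightarrow> bool" where
  "cornering_won t r n h \<longleftrightarrow>
     (\<exists>c\<in>{1..t}. \<forall>\<chi>\<in>valid_colorings t r n.
        compatible t n h \<chi> \<longrightarrow> contains_matching r (color_class n \<chi> c))"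

definition cornering_number :: "nat \<Rightarrow> nat \<Rightarrow> nat \<Rightarrow> nat" where
  "cornering_number t r n =
     (LEAST l. \<exists>S. guarantees_win n (valid_colorings t r n) (cornering_won t r n) l S)"

end

theory Submission
  imports Defs
begin

text \<open>Write \<open>s = r - 1\<close>. Both bounds come from one coloring that avoids monochromatic
  \<open>rK\<^sub>2\<close> on \<open>n = (t + 1) s + 1\<close> vertices: take consecutive blocks
  \<open>A\<^sub>1, \<dots>, A\<^sub>t\<^sub>-\<^sub>1\<close> of \<open>s\<close> vertices, give color \<open>i\<close> to an edge whose smaller
  endpoint lies in \<open>A\<^sub>i\<close>, and color \<open>t\<close> to all edges inside the remaining block \<open>A\<^sub>0\<close> of
  \<open>2 s + 1\<close> vertices. A matching of color \<open>i < t\<close> has at most \<open>|A\<^sub>i| = s\<close> edges, and one of color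
  \<open>t\<close> at most \<open>s\<close> because \<open>A\<^sub>0\<close> is too small.

  In this coloring a single edge \<open>e\<close> can always be recolored so that \<open>rK\<^sub>2\<close> appears, in the new
  color only. If \<open>e\<close> is not contained in \<open>A\<^sub>0\<close>, give it color \<open>t\<close>: at least \<open>2 s\<close> vertices of
  \<open>A\<^sub>0\<close> lie off \<open>e\<close> and carry \<open>s\<close> disjoint edges of color \<open>t\<close>. If \<open>e\<close> avoids \<open>A\<^sub>1\<close>, give it
  color \<open>1\<close>: the vertices of \<open>A\<^sub>1\<close> can be matched to vertices off \<open>e\<close>. Since \<open>t \<ge> 2\<close>, these
  two cases cover all edges. Hence, when Painter answers by this coloring, Builder cannot win the
  locating game while one edge is hidden (\<open>locating_number_eq\<close>). In the cornering game Builder has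
  to expose all edges that can be recolored to \<open>1\<close>, or all those that can be recolored to \<open>t\<close>;
  otherwise two valid completions with disjoint sets of winning colors remain
  (\<open>cornering_number_ge\<close>). Both sets of edges have size at least \<open>n\<^sup>2 / 8\<close>.

  It remains to see that \<open>n\<close> is \<open>R\<^sub>t(rK\<^sub>2) - 1\<close>, which is the theorem of Cockayne and Lorimer
  (\<open>matching_Ramsey_eq\<close>). Its upper bound says that if \<open>K\<^sub>m\<close> is a union of graphs \<open>G\<^sub>i\<close> with matching
  numbers at most \<open>a\<^sub>i \<le> b\<close>, then \<open>m \<le> (\<Sum>\<^sub>i a\<^sub>i) + b + 1\<close> (\<open>covered_complete_graph_bound\<close>). If
  deleting some vertex lowers the matching number of some \<open>G\<^sub>i\<close>, both sides drop by one and
  induction applies. Otherwise every vertex is missed by a maximum matching of every \<open>G\<^sub>i\<close>, and the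
  exchange argument of Gallai's lemma shows that \<open>G\<^sub>i\<close> has at most \<open>a\<^sub>i (2 a\<^sub>i + 1)\<close> edges, as many
  as a clique on \<open>2 a\<^sub>i + 1\<close> vertices (\<open>card_edges_if_every_vertex_missable\<close>). Comparing the number
  of edges of \<open>K\<^sub>m\<close> with the sum of these bounds finishes the proof.\<close>

section \<open>Matchings\<close>

lemma twice_choose_two: "2 * (n choose 2) = n * (n - 1)"
proof -
  have "even (n * (n - 1))"
    by (cases n) auto
  then show ?thesis
    by (simp add: choose_two)
qed

text \<open>Matchings over an arbitrary vertex type. That the members are edges is left to the context, where
  they always belong to some graph.\<close>

definition matching :: "'a set set \<Rightarrow> bool" where
  "matching M \<longleftrightarrow> finite M \<and> pairwise disjnt M"

lemma contains_matching_iff: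
  "contains_matching r F \<longleftrightarrow> (\<exists>M\<subseteq>F. matching M \<and> card M = r)"
  by (auto simp: contains_matching_def matching_def)

lemma contains_matching_mono:
  "contains_matching r F \<Longrightarrow> F \<subseteq> G \<Longrightarrow> contains_matching r G"
  by (auto simp: contains_matching_def)

lemma matching_subset: "matching M \<Longrightarrow> N \<subseteq> M \<Longrightarrow> matching N"
  by (auto simp: matching_def finite_subset pairwise_subset)

lemma matching_insert:
  assumes "matching M" "e \<inter> \<Union>M = {}"
  shows "matching (insert e M)"
  using assms by (auto simp: matching_def pairwise_insert disjnt_def)

lemma matching_unique:
  "matching M \<Longrightarrow> e \<in> M \<Longrightarrow> f \<in> M \<Longrightarrow> x \<in> e \<Longrightarrow> x \<in> f \<Longrightarrow> e = f"
  by (auto simp: matching_def pairwise_def disjnt_def)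

lemma card_Union_matching:
  assumes "matching M" "\<forall>e\<in>M. card e = 2"
  shows "finite (\<Union>M)" "card (\<Union>M) = 2 * card M"
proof -
  have fin: "finite e" if "e \<in> M" for e
    using assms(2) that card.infinite by fastforce
  then show "finite (\<Union>M)"
    using assms(1) by (auto simp: matching_def)
  have "card (\<Union>M) = sum card M"
    using assms(1) fin by (intro card_Union_disjoint) (auto simp: matching_def)
  then show "card (\<Union>M) = 2 * card M"
    using assms(2) by simp
qed

lemma ex_matching_in_complete:
  assumes "finite A" "2 * s \<le> card A"
  shows "\<exists>M\<subseteq>nsets A 2. matching M \<and> card M = s"
  using assms
proof (induction s arbitrary: A)
  case 0
  show ?case
    by (rule exI[of _ "{}"]) (auto simp: matching_def)
next
  case (Suc s)
  obtain e where e: "e \<subseteq> A" "card e = 2"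
    using obtain_subset_with_card_n[of 2 A] Suc.prems by auto
  have "finite e"
    using e Suc.prems finite_subset by blast
  have "2 * s \<le> card (A - e)"
    using Suc.prems e \<open>finite e\<close> by (simp add: card_Diff_subset)
  then obtain M where M: "M \<subseteq> nsets (A - e) 2" "matching M" "card M = s"
    using Suc.IH[of "A - e"] Suc.prems by auto
  have disj: "e \<inter> \<Union>M = {}"
    using M(1) by (fastforce simp: nsets_def)
  have "e \<notin> M"
    using disj e(2) by (metis Int_absorb2 Sup_upper card.empty zero_neq_numeral)
  then have "card (insert e M) = Suc s"
    using M by (simp add: matching_def)
  moreover have "insert e M \<subseteq> nsets A 2"
    using M(1) e \<open>finite e\<close> by (auto simp: nsets_def)
  ultimately show ?case
    using matching_insert[OF M(2) disj] by blast
qed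

section \<open>Graphs all of whose vertices can be missed by a maximum matching\<close>

lemma no_larger_matching_meets_edge:
  assumes "\<nexists>M. M \<subseteq> G \<and> matching M \<and> card M = Suc a"
    and "M \<subseteq> G" "matching M" "card M = a" "e \<in> G" "e \<noteq> {}"
  shows "e \<inter> \<Union>M \<noteq> {}"
proof
  assume disj: "e \<inter> \<Union>M = {}"
  then have "e \<notin> M"
    using \<open>e \<noteq> {}\<close> by blast
  then have "card (insert e M) = Suc a"
    using assms by (simp add: matching_def)
  then show False
    using assms(1) matching_insert[OF assms(3) disj] assms(2,5) by blast
qed

text \<open>The exchange step of Gallai's lemma. Among the maximum matchings \<open>N\<close> that miss \<open>w\<close>, consider one
  with as few edges outside \<open>M\<close> as possible. It covers \<open>u\<close> and \<open>v\<close>, or an edge at \<open>w\<close> would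
  enlarge it. As \<open>M\<close> and \<open>N\<close> cover equally many vertices, \<open>M\<close> covers at least two
  vertices that \<open>N\<close> misses, and so one, say \<open>x\<close>, besides \<open>w\<close>. Exchanging an edge of
  \<open>N\<close> for the edge of \<open>M\<close> at \<open>x\<close> brings \<open>N\<close> closer to \<open>M\<close> while it still misses \<open>w\<close>.\<close>

lemma no_common_neighbour_of_missed:
  assumes edges: "\<forall>e\<in>G. card e = 2"
    and max: "\<nexists>M. M \<subseteq> G \<and> matching M \<and> card M = Suc a"
    and M: "M \<subseteq> G" "matching M" "card M = a" "u \<notin> \<Union>M" "v \<notin> \<Union>M"
    and adj: "u \<noteq> v" "{u, w} \<in> G" "{v, w} \<in> G"
    and N: "N \<subseteq> G" "matching N" "card N = a" "w \<notin> \<Union>N"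
  shows False
  using N
proof (induction "card (N - M)" arbitrary: N rule: less_induct)
  case less
  note N = less.prems
  note meets = no_larger_matching_meets_edge[OF max]
  have u: "u \<in> \<Union>N" and v: "v \<in> \<Union>N"
    using meets[OF N(1-3) adj(2)] meets[OF N(1-3) adj(3)] N(4) by auto
  have "\<forall>e\<in>M. card e = 2" "\<forall>e\<in>N. card e = 2"
    using M(1) N(1) edges by blast+
  then have cM: "finite (\<Union>M)" "card (\<Union>M) = 2 * a" and cN: "finite (\<Union>N)" "card (\<Union>N) = 2 * a"
    using card_Union_matching[OF M(2)] card_Union_matching[OF N(2)] M(3) N(3) by simp_all
  have "card (\<Union>M - \<Union>N) = card (\<Union>N - \<Union>M)"
    using cM cN by (simp add: card_Diff_subset_Int Int_commute)
  moreover have "card {u, v} \<le> card (\<Union>N - \<Union>M)"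
    using u v M(4,5) cN by (intro card_mono) auto
  ultimately have "2 \<le> card (\<Union>M - \<Union>N)"
    using adj(1) by simp
  then have "\<not> \<Union>M - \<Union>N \<subseteq> {w}"
    using card_mono[of "{w}" "\<Union>M - \<Union>N"] by auto
  then obtain x where x: "x \<in> \<Union>M" "x \<notin> \<Union>N" "x \<noteq> w"
    by blast
  then obtain f where f: "f \<in> M" "x \<in> f"
    by blast
  have "f \<in> G"
    using f M by blast
  then obtain y where y: "f = {x, y}" "y \<noteq> x"
  proof -
    have "card f = 2"
      using edges \<open>f \<in> G\<close> by blast
    then show ?thesis
      using that f(2) unfolding card_2_iff by blast
  qed
  have "y \<in> \<Union>N"
    using meets[OF N(1-3) \<open>f \<in> G\<close>] y x by auto
  then obtain g where g: "g \<in> N" "y \<in> g"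
    by blast
  have "g \<notin> M"
    using matching_unique[OF M(2) f(1), of g y] g y x by auto
  define N' where "N' = insert f (N - {g})"
  have disj: "f \<inter> \<Union>(N - {g}) = {}"
  proof -
    have "x \<notin> \<Union>(N - {g})"
      using x(2) by blast
    moreover have "y \<notin> \<Union>(N - {g})"
      using matching_unique[OF N(2) g(1) _ g(2)] by blast
    ultimately show ?thesis
      using y(1) by blast
  qed
  have "f \<notin> N"
    using x f by blast
  have "finite N"
    using N by (simp add: matching_def)
  have "card N' = a"
    using g \<open>f \<notin> N\<close> \<open>finite N\<close> N(3) card_Suc_Diff1[of N g] by (simp add: N'_def)
  moreover have "matching N'"
    unfolding N'_def using disj matching_subset[OF N(2)] by (intro matching_insert) auto
  moreover have "N' \<subseteq> G"
    using N \<open>f \<in> G\<close> by (auto simp: N'_def)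
  moreover have "w \<notin> \<Union>N'"
    using N(4) y x \<open>y \<in> \<Union>N\<close> by (auto simp: N'_def)
  moreover have "N' - M \<subset> N - M"
    using f g \<open>g \<notin> M\<close> by (auto simp: N'_def)
  then have "card (N' - M) < card (N - M)"
    using \<open>finite N\<close> by (intro psubset_card_mono) auto
  ultimately show False
    using less.hyps by blast
qed

text \<open>Fix a maximum matching \<open>M\<close>. Every edge meets one of its \<open>2 a\<close> vertices. At most
  \<open>a (2 a - 1)\<close> edges lie inside \<open>\<Union>M\<close>, and each vertex of \<open>\<Union>M\<close> has at most one neighbour outside
  \<open>\<Union>M\<close>, since two such neighbours would contradict Gallai's exchange step. The clique on
  \<open>2 a + 1\<close> vertices attains the bound.\<close>

lemma card_edges_if_every_vertex_missable:
  assumes "finite V" and G: "G \<subseteq> nsets V 2"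
    and max: "\<nexists>M. M \<subseteq> G \<and> matching M \<and> card M = Suc a"
    and miss: "\<And>w. w \<in> V \<Longrightarrow> \<exists>N\<subseteq>G. matching N \<and> card N = a \<and> w \<notin> \<Union>N"
  shows "card G \<le> a * (2 * a + 1)"
proof (cases "V = {}")
  case True
  then have "G = {}"
    using G by (auto simp: nsets_def)
  then show ?thesis
    by simp
next
  case False
  then obtain M where M: "M \<subseteq> G" "matching M" "card M = a"
    using miss by blast
  have edges: "\<forall>e\<in>G. card e = 2"
    using G by (auto simp: nsets_def)
  have "\<forall>e\<in>M. card e = 2"
    using M(1) edges by blast
  then have cM: "finite (\<Union>M)" "card (\<Union>M) = 2 * a"
    using card_Union_matching[OF M(2)] M(3) by simp_all
  \<comment> \<open>The edges that leave \<open>\<Union>M\<close>; \<open>f\<close> will pick the endpoint covered by \<open>M\<close>.\<close>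
  define B where "B = {e \<in> G. \<exists>w\<in>\<Union>M. \<exists>u. u \<notin> \<Union>M \<and> e = {u, w}}"
  have "\<forall>e\<in>B. \<exists>w. w \<in> \<Union>M \<and> (\<exists>u. u \<notin> \<Union>M \<and> e = {u, w})"
    by (auto simp: B_def)
  then obtain f where f: "\<And>e. e \<in> B \<Longrightarrow> f e \<in> \<Union>M \<and> (\<exists>u. u \<notin> \<Union>M \<and> e = {u, f e})"
    by metis
  have "inj_on f B"
  proof (rule inj_onI)
    fix e e' assume e: "e \<in> B" "e' \<in> B" "f e = f e'"
    obtain u where u: "u \<notin> \<Union>M" "e = {u, f e}"
      using f[OF e(1)] by blast
    obtain v where v: "v \<notin> \<Union>M" "e' = {v, f e}"
      using f[OF e(2)] unfolding e(3) by blast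
    note uv = u v
    have inG: "{u, f e} \<in> G" "{v, f e} \<in> G"
      using e(1,2) unfolding u(2)[symmetric] v(2)[symmetric] by (simp_all add: B_def)
    have "f e \<in> V"
      using inG(1) G by (auto simp: nsets_def)
    then obtain N where N: "N \<subseteq> G" "matching N" "card N = a" "f e \<notin> \<Union>N"
      using miss by blast
    have "u = v"
      using no_common_neighbour_of_missed[OF edges max M uv(1,3) _ inG N] by blast
    then show "e = e'"
      using u(2) v(2) by simp
  qed
  then have cB: "card B \<le> 2 * a"
    using card_inj_on_le[of f B "\<Union>M"] f cM by (metis image_subsetI)
  have "G \<subseteq> nsets (\<Union>M) 2 \<union> B"
  proof
    fix e assume e: "e \<in> G"
    then obtain x y where xy: "e = {x, y}" "x \<noteq> y"
      using edges by (auto simp: card_2_iff)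
    have "e \<inter> \<Union>M \<noteq> {}"
      using no_larger_matching_meets_edge[OF max M e] xy by blast
    then consider "x \<in> \<Union>M" "y \<in> \<Union>M" | "x \<in> \<Union>M" "y \<notin> \<Union>M" | "x \<notin> \<Union>M" "y \<in> \<Union>M"
      using xy by blast
    then show "e \<in> nsets (\<Union>M) 2 \<union> B"
    proof cases
      case 1
      then show ?thesis
        using xy by (auto simp: nsets_def)
    next
      case 2
      have "e = {y, x}"
        using xy by blast
      then have "e \<in> B"
        unfolding B_def using 2 e by blast
      then show ?thesis ..
    next
      case 3
      then have "e \<in> B"
        unfolding B_def using xy e by blast
      then show ?thesis ..
    qed
  qed
  moreover have "finite (nsets (\<Union>M) 2)" "finite B"
    using cM G \<open>finite V\<close> by (auto simp: B_def finite_imp_finite_nsets intro: finite_subset)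
  ultimately have "card G \<le> card (nsets (\<Union>M) 2) + card B"
    using card_mono[OF finite_UnI, of "nsets (\<Union>M) 2" B G] card_Un_le[of "nsets (\<Union>M) 2" B] by linarith
  also have "\<dots> \<le> (2 * a choose 2) + 2 * a"
    using cB cM by (simp add: card_nsets)
  also have "\<dots> = a * (2 * a + 1)"
    using twice_choose_two[of "2 * a"] by (cases a) (simp_all add: algebra_simps)
  finally show ?thesis .
qed

section \<open>The Ramsey number of a matching\<close>

text \<open>The bounds \<open>a i\<close> vary with the color so that a vertex meeting all maximum matchings of one
  color can be deleted at the cost of one unit of that color, while the common bound \<open>b\<close> stays fixed.
  When there is no such vertex, the edge counts give
  \<open>m (m - 1) \<le> 2 A (2 b + 1)\<close> with \<open>A = sum a I\<close>, which is incompatible with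
  \<open>m \<ge> A + b + 2\<close> because \<open>(A + b)\<^sup>2 \<ge> 4 A b\<close>.\<close>

lemma covered_complete_graph_bound:
  fixes G :: "'i \<Rightarrow> 'a set set"
  assumes "finite I" "finite V" "nsets V 2 \<subseteq> (\<Union>i\<in>I. G i)"
    and "\<And>i. i \<in> I \<Longrightarrow> a i \<le> b"
    and "\<And>i M. i \<in> I \<Longrightarrow> M \<subseteq> G i \<Longrightarrow> matching M \<Longrightarrow> card M \<noteq> Suc (a i)"
  shows "card V \<le> sum a I + b + 1"
  using assms(2-)
proof (induction "card V" arbitrary: V G a rule: less_induct)
  case less
  note cover = less.prems(2) and le_b = less.prems(3) and max = less.prems(4)
  \<comment> \<open>The \<open>i\<close>-th graph after deleting the vertex \<open>w\<close>.\<close>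
  define H where "H i w = {e \<in> G i \<inter> nsets V 2. w \<notin> e}" for i w
  show ?case
  proof (cases "\<exists>i\<in>I. \<exists>w\<in>V. \<forall>N\<subseteq>H i w. matching N \<longrightarrow> card N \<noteq> a i")
    case True
    then obtain i w where iw: "i \<in> I" "w \<in> V"
      and no: "\<And>N. N \<subseteq> H i w \<Longrightarrow> matching N \<Longrightarrow> card N \<noteq> a i"
      by blast
    \<comment> \<open>The empty matching always exists, so the subtraction below is not truncated.\<close>
    have "a i \<noteq> 0"
      using no[of "{}"] by (auto simp: matching_def)
    define a' where "a' = a(i := a i - 1)"
    define G' where "G' = G(i := H i w)"
    have "card (V - {w}) < card V"
      using iw less.prems(1) by (intro psubset_card_mono) auto
    moreover have "nsets (V - {w}) 2 \<subseteq> (\<Union>j\<in>I. G' j)"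
    proof
      fix e assume e: "e \<in> nsets (V - {w}) 2"
      then have "e \<in> nsets V 2" "w \<notin> e"
        by (auto simp: nsets_def)
      then obtain j where "j \<in> I" "e \<in> G j"
        using cover by blast
      then show "e \<in> (\<Union>j\<in>I. G' j)"
        using \<open>e \<in> nsets V 2\<close> \<open>w \<notin> e\<close> by (auto simp: G'_def H_def)
    qed
    moreover have "a' j \<le> b" if "j \<in> I" for j
      using le_b[OF that] by (auto simp: a'_def)
    moreover have "card M \<noteq> Suc (a' j)" if "j \<in> I" "M \<subseteq> G' j" "matching M" for j M
      using max[of j M] no[of M] that \<open>a i \<noteq> 0\<close> by (cases "j = i") (auto simp: a'_def G'_def)
    ultimately have "card (V - {w}) \<le> sum a' I + b + 1"
      using less.hyps[of "V - {w}" G' a'] less.prems(1) by blast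
    moreover have "sum a I = a i + sum a (I - {i})" "sum a' I = a' i + sum a' (I - {i})"
      using iw assms(1) by (auto intro: sum.remove)
    moreover have "sum a' (I - {i}) = sum a (I - {i})"
      by (intro sum.cong) (auto simp: a'_def)
    ultimately show ?thesis
      using iw less.prems(1) \<open>a i \<noteq> 0\<close> by (simp add: a'_def)
  next
    case False
    have edges: "card (G i \<inter> nsets V 2) \<le> a i * (2 * a i + 1)" if "i \<in> I" for i
    proof (rule card_edges_if_every_vertex_missable[OF less.prems(1)])
      show "\<nexists>M. M \<subseteq> G i \<inter> nsets V 2 \<and> matching M \<and> card M = Suc (a i)"
        using max[OF \<open>i \<in> I\<close>] by blast
      show "\<exists>N\<subseteq>G i \<inter> nsets V 2. matching N \<and> card N = a i \<and> w \<notin> \<Union>N" if "w \<in> V" for w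
      proof -
        obtain N where "N \<subseteq> H i w" "matching N" "card N = a i"
          using False \<open>i \<in> I\<close> \<open>w \<in> V\<close> by blast
        then show ?thesis
          by (intro exI[of _ N]) (auto simp: H_def)
      qed
    qed auto
    have "(card V choose 2) = card (nsets V 2)"
      by (simp add: card_nsets)
    also have "\<dots> \<le> card (\<Union>i\<in>I. G i \<inter> nsets V 2)"
      using cover less.prems(1) assms(1)
      by (intro card_mono) (auto simp: finite_imp_finite_nsets)
    also have "\<dots> \<le> (\<Sum>i\<in>I. card (G i \<inter> nsets V 2))"
      using assms(1) by (rule card_UN_le)
    also have "\<dots> \<le> (\<Sum>i\<in>I. a i * (2 * b + 1))"
      using edges le_b by (intro sum_mono) (meson add_le_mono1 le_trans mult_le_mono2)
    also have "\<dots> = sum a I * (2 * b + 1)"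
      by (rule sum_distrib_right[symmetric])
    finally have count: "card V choose 2 \<le> sum a I * (2 * b + 1)" .
    show ?thesis
    proof (rule ccontr)
      define A where "A = sum a I"
      assume "\<not> ?thesis"
      then have "A + b + 2 \<le> card V"
        by (simp add: A_def)
      then have "(A + b + 2) * (A + b + 1) \<le> card V * (card V - 1)"
        by (intro mult_le_mono) auto
      also have "\<dots> = 2 * (card V choose 2)"
        by (rule twice_choose_two[symmetric])
      also have "\<dots> \<le> 2 * (A * (2 * b + 1))"
        using count by (simp add: A_def)
      finally have "int ((A + b + 2) * (A + b + 1)) \<le> int (2 * (A * (2 * b + 1)))"
        by (simp only: of_nat_le_iff)
      then have "(int A - int b)\<^sup>2 + int A + 3 * int b + 2 \<le> 0"
        by (simp add: power2_eq_square algebra_simps)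
      then show False
        using zero_le_power2[of "int A - int b"] by linarith
    qed
  qed
qed

text \<open>The block of a vertex \<open>x\<close> is \<open>x div s\<close>, counted from \<open>0\<close>, and everything from block \<open>t - 1\<close>
  on is merged into one last block by the minimum with \<open>t\<close>. An edge is colored by the block of its
  smaller endpoint.\<close>

definition extremal_coloring :: "nat \<Rightarrow> nat \<Rightarrow> nat set \<Rightarrow> nat" where
  "extremal_coloring t s e = min t (Min e div s + 1)"

abbreviation critical_order :: "nat \<Rightarrow> nat \<Rightarrow> nat" where
  "critical_order t s \<equiv> (t + 1) * s + 1"

lemma K_edgesE:
  assumes "e \<in> K_edges n"
  obtains x y where "e = {x, y}" "x < y" "y < n"
proof -
  have e: "e \<subseteq> {..<n}" "card e = 2"
    using assms by (simp_all add: K_edges_def nsets_def)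
  obtain x y where xy: "e = {x, y}" "x \<noteq> y"
    using e(2) unfolding card_2_iff by blast
  have "x < n" "y < n" "e = {y, x}"
    using e(1) unfolding xy(1) by auto
  show ?thesis
  proof (cases "x < y")
    case True
    show ?thesis
      by (rule that[OF xy(1) True \<open>y < n\<close>])
  next
    case False
    then have "y < x"
      using xy(2) by simp
    show ?thesis
      by (rule that[OF \<open>e = {y, x}\<close> \<open>y < x\<close> \<open>x < n\<close>])
  qed
qed

lemma finite_K_edges: "finite (K_edges n)"
  by (simp add: K_edges_def finite_imp_finite_nsets)

lemma card_K_edges: "card (K_edges n) = n choose 2"
  by (simp add: K_edges_def card_nsets)

lemma extremal_coloring_in_colorings: "1 \<le> t \<Longrightarrow> extremal_coloring t s \<in> colorings t n"
  by (auto simp: colorings_def extremal_coloring_def)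

text \<open>Edges of a color \<open>i < t\<close> have their smaller endpoint in a block of \<open>s\<close> vertices, and disjoint edges
  have different smaller endpoints. Edges of color \<open>t\<close> lie within the last
  \<open>2 s + 1\<close> vertices, too few for \<open>s + 1\<close> disjoint edges.\<close>

lemma extremal_coloring_no_mono_matching:
  assumes s: "1 \<le> s" and n: "n \<le> critical_order t s"
  shows "\<not> has_mono_matching t (Suc s) n (extremal_coloring t s)"
proof
  assume "has_mono_matching t (Suc s) n (extremal_coloring t s)"
  then obtain i M where i: "1 \<le> i" "i \<le> t"
    and M: "M \<subseteq> color_class n (extremal_coloring t s) i" "matching M" "card M = Suc s"
    by (auto simp: has_mono_matching_def contains_matching_iff)
  have edge: "\<exists>x y. e = {x, y} \<and> x < y \<and> y < n \<and> min t (x div s + 1) = i" if "e \<in> M" for e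
  proof -
    have "e \<in> K_edges n" "extremal_coloring t s e = i"
      using M that by (auto simp: color_class_def)
    then show ?thesis
      by (elim K_edgesE) (auto simp: extremal_coloring_def)
  qed
  show False
  proof (cases "i = t")
    case True
    have "\<Union>M \<subseteq> {(t - 1) * s..<n}"
    proof
      fix z assume "z \<in> \<Union>M"
      then obtain e where "e \<in> M" "z \<in> e"
        by blast
      then obtain x y where xy: "e = {x, y}" "x < y" "y < n" "min t (x div s + 1) = t"
        using edge True by blast
      then have "t - 1 \<le> x div s"
        by linarith
      then have "(t - 1) * s \<le> x"
        using s by (simp add: less_eq_div_iff_mult_less_eq)
      then show "z \<in> {(t - 1) * s..<n}"
        using xy \<open>z \<in> e\<close> by auto
    qed
    then have "card (\<Union>M) \<le> n - (t - 1) * s"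
      using card_mono[of "{(t - 1) * s..<n}"] by simp
    also have "\<dots> \<le> critical_order t s - (t - 1) * s"
      using n by (rule diff_le_mono)
    also have "\<dots> = 2 * s + 1"
      using i True by (cases t) (auto simp: algebra_simps)
    finally have "card (\<Union>M) \<le> 2 * s + 1" .
    moreover have "card (\<Union>M) = 2 * Suc s"
      using card_Union_matching(2)[OF M(2)] M(3) edge by fastforce
    ultimately show False
      by simp
  next
    case False
    have "inj_on Min M"
    proof (rule inj_onI)
      fix e f assume "e \<in> M" "f \<in> M" "Min e = Min f"
      moreover have "Min e \<in> e" "Min f \<in> f"
        using edge[OF \<open>e \<in> M\<close>] edge[OF \<open>f \<in> M\<close>] by auto
      ultimately show "e = f"
        using matching_unique[OF M(2)] by metis
    qed
    moreover have "Min ` M \<subseteq> {(i - 1) * s..<(i - 1) * s + s}"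
    proof
      fix z assume "z \<in> Min ` M"
      then obtain e where e: "e \<in> M" "z = Min e"
        by blast
      then obtain y where xy: "e = {z, y}" "z < y" "min t (z div s + 1) = i"
        using edge[OF e(1)] by auto
      then have "z div s = i - 1"
        using i False by linarith
      moreover have "z = z div s * s + z mod s" "z mod s < s"
        using s by auto
      ultimately show "z \<in> {(i - 1) * s..<(i - 1) * s + s}"
        by (metis add_less_cancel_left atLeastLessThan_iff le_add1)
    qed
    ultimately have "card M \<le> s"
      using card_inj_on_le[of Min M "{(i - 1) * s..<(i - 1) * s + s}"] by simp
    then show False
      using M(3) by simp
  qed
qed

text \<open>The diagonal case of the Cockayne--Lorimer theorem on Ramsey numbers of matchings. The extremal
  coloring restricts to all smaller complete graphs, as minimality requires.\<close>

theorem matching_Ramsey_eq: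
  assumes "1 \<le> t" "1 \<le> s"
  shows "matching_Ramsey t (Suc s) = Suc (critical_order t s)"
  unfolding matching_Ramsey_def
proof (rule Least_equality)
  show "\<forall>\<chi>\<in>colorings t (Suc (critical_order t s)).
          has_mono_matching t (Suc s) (Suc (critical_order t s)) \<chi>"
  proof (rule ballI, rule ccontr)
    define n where "n = Suc (critical_order t s)"
    fix \<chi> assume \<chi>: "\<chi> \<in> colorings t (Suc (critical_order t s))"
      and "\<not> has_mono_matching t (Suc s) (Suc (critical_order t s)) \<chi>"
    then have no: "card M \<noteq> Suc s"
      if "i \<in> {1..t}" "M \<subseteq> color_class n \<chi> i" "matching M" for i M
      using that by (auto simp: has_mono_matching_def contains_matching_iff n_def)
    have cover: "nsets {..<n} 2 \<subseteq> (\<Union>i\<in>{1..t}. color_class n \<chi> i)"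
      using \<chi> by (auto simp: colorings_def color_class_def K_edges_def n_def)
    have "card {..<n} \<le> (\<Sum>i\<in>{1..t}. s) + s + 1"
      by (rule covered_complete_graph_bound[OF _ _ cover]) (use no in auto)
    then show False
      by (simp add: n_def)
  qed
next
  fix n assume n: "\<forall>\<chi>\<in>colorings t n. has_mono_matching t (Suc s) n \<chi>"
  show "Suc (critical_order t s) \<le> n"
  proof (rule ccontr)
    assume "\<not> Suc (critical_order t s) \<le> n"
    then show False
      using extremal_coloring_no_mono_matching[OF assms(2), of n t]
        extremal_coloring_in_colorings[OF assms(1)] n by auto
  qed
qed

section \<open>Critical edges\<close>

definition critical_edges :: "nat \<Rightarrow> nat \<Rightarrow> (nat set \<Rightarrow> nat) \<Rightarrow> nat \<Rightarrow> nat set set" where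
  "critical_edges r n \<chi> j =
     {e \<in> K_edges n. contains_matching r (color_class n (\<chi>(e := j)) j)}"

lemma critical_edgesI:
  assumes "e \<in> K_edges n" "M \<subseteq> color_class n \<chi> j" "matching M" "card M = s" "e \<inter> \<Union>M = {}"
  shows "e \<in> critical_edges (Suc s) n \<chi> j"
proof -
  have "e \<noteq> {}"
    using assms(1) by (auto elim: K_edgesE)
  then have "e \<notin> M"
    using assms(5) by blast
  then have "card (insert e M) = Suc s"
    using assms by (simp add: matching_def)
  moreover have "insert e M \<subseteq> color_class n (\<chi>(e := j)) j"
    using assms(1,2) by (auto simp: color_class_def)
  ultimately have "contains_matching (Suc s) (color_class n (\<chi>(e := j)) j)"
    using matching_insert[OF assms(3,5)] unfolding contains_matching_iff by blast
  then show ?thesis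
    using assms(1) by (simp add: critical_edges_def)
qed

text \<open>The first block consists of \<open>s\<close> vertices whose edges all have color \<open>1\<close>. An edge \<open>e\<close> that avoids
  it leaves \<open>t s - 1 \<ge> s\<close> later vertices free, to which the first block can be matched.\<close>

lemma critical_edges_first_color:
  assumes "2 \<le> t" "1 \<le> s" "e \<in> nsets {s..<critical_order t s} 2"
  shows "e \<in> critical_edges (Suc s) (critical_order t s) (extremal_coloring t s) 1"
proof -
  define n where "n = critical_order t s"
  have e: "e \<subseteq> {s..<n}" "finite e" "card e = 2" "e \<in> K_edges n"
    using assms(3) by (auto simp: nsets_def K_edges_def n_def)
  have "2 * s \<le> t * s"
    using assms(1) by (rule mult_le_mono1)
  then have "s \<le> t * s + 1 - 2"
    using assms(2) by linarith
  then have "card {..<s} \<le> card ({s..<n} - e)"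
    using e by (simp add: card_Diff_subset n_def)
  then obtain f where f: "f ` {..<s} \<subseteq> {s..<n} - e" "inj_on f {..<s}"
    by (meson card_le_inj finite_Diff finite_atLeastLessThan finite_lessThan)
  have f_ge: "s \<le> f k" "f k < n" "f k \<notin> e" if "k < s" for k
    using f(1) that by auto
  define M where "M = (\<lambda>k. {k, f k}) ` {..<s}"
  have disj: "{j, f j} \<inter> {k, f k} = {}" if "j < s" "k < s" "j \<noteq> k" for j k
    using f_ge[OF that(1)] f_ge[OF that(2)] that inj_onD[OF f(2), of j k] by auto
  have "matching M"
    using disj by (fastforce simp: M_def matching_def pairwise_def disjnt_def)
  moreover have "inj_on (\<lambda>k. {k, f k}) {..<s}"
    using disj by (fastforce intro: inj_onI)
  then have "card M = s"
    by (simp add: M_def card_image)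
  moreover have "M \<subseteq> color_class n (extremal_coloring t s) 1"
  proof
    fix g assume "g \<in> M"
    then obtain k where k: "k < s" "g = {k, f k}"
      by (auto simp: M_def)
    then show "g \<in> color_class n (extremal_coloring t s) 1"
      using f_ge[OF k(1)] assms
      by (auto simp: color_class_def extremal_coloring_def K_edges_def nsets_def min_def)
  qed
  moreover have "e \<inter> \<Union>M = {}"
    using f_ge e(1) by (fastforce simp: M_def)
  ultimately show ?thesis
    using critical_edgesI[OF e(4)] unfolding n_def by blast
qed

text \<open>An edge that leaves the last block uses at most one of its \<open>2 s + 1\<close> vertices, and the others
  still carry \<open>s\<close> disjoint edges of color \<open>t\<close>.\<close>

lemma critical_edges_last_color:
  assumes "1 \<le> t" "1 \<le> s" "e \<in> K_edges (critical_order t s)"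
    and "\<not> e \<subseteq> {(t - 1) * s..<critical_order t s}"
  shows "e \<in> critical_edges (Suc s) (critical_order t s) (extremal_coloring t s) t"
proof -
  define n where "n = critical_order t s"
  define A where "A = {(t - 1) * s..<n}"
  have e: "finite e" "card e = 2"
    using assms(3) by (auto simp: K_edges_def nsets_def)
  have "card (e \<inter> A) < card e"
    using e assms(4) by (intro psubset_card_mono) (auto simp: A_def n_def)
  then have "card (e \<inter> A) \<le> 1"
    using e by simp
  moreover have "card A = 2 * s + 1"
    using assms(1) by (cases t) (auto simp: A_def n_def algebra_simps)
  moreover have "card (A - e) = card A - card (e \<inter> A)"
    using e by (simp add: card_Diff_subset_Int Int_commute)
  ultimately have "2 * s \<le> card (A - e)"
    by linarith
  then obtain M where M: "M \<subseteq> nsets (A - e) 2" "matching M" "card M = s"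
    using ex_matching_in_complete[of "A - e" s] by (auto simp: A_def)
  have "M \<subseteq> color_class n (extremal_coloring t s) t"
  proof
    fix g assume g: "g \<in> M"
    then have sub: "g \<subseteq> A" "finite g" "card g = 2"
      using M(1) by (auto simp: nsets_def)
    then have "Min g \<in> A"
      using Min_in[of g] by fastforce
    then have "t - 1 \<le> Min g div s"
      using assms(2) by (simp add: A_def less_eq_div_iff_mult_less_eq)
    then have "extremal_coloring t s g = t"
      by (simp add: extremal_coloring_def)
    then show "g \<in> color_class n (extremal_coloring t s) t"
      using sub by (auto simp: color_class_def K_edges_def nsets_def A_def)
  qed
  moreover have "e \<inter> \<Union>M = {}"
    using M(1) by (fastforce simp: nsets_def)
  ultimately show ?thesis
    using critical_edgesI[of e n M] assms(3) M unfolding n_def by blast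
qed

lemma every_edge_critical:
  assumes "2 \<le> t" "1 \<le> s" "e \<in> K_edges (critical_order t s)"
  shows "\<exists>j\<in>{1..t}. e \<in> critical_edges (Suc s) (critical_order t s) (extremal_coloring t s) j"
proof (cases "e \<subseteq> {(t - 1) * s..<critical_order t s}")
  case True
  have "1 * s \<le> (t - 1) * s"
    using assms(1) by (intro mult_le_mono1) simp
  then have "{(t - 1) * s..<critical_order t s} \<subseteq> {s..<critical_order t s}"
    by simp
  then have "e \<in> nsets {s..<critical_order t s} 2"
    using True assms(3) unfolding K_edges_def nsets_def by blast
  then show ?thesis
    using critical_edges_first_color[OF assms(1,2)] assms(1) by (intro bexI[of _ 1]) auto
next
  case False
  then show ?thesis
    using critical_edges_last_color[OF _ assms(2,3)] assms(1) by (intro bexI[of _ t]) auto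
qed

text \<open>There are \<open>t s (t s + 1) / 2\<close> edges avoiding the first block, and \<open>n \<le> 2 t s\<close>.\<close>

lemma card_critical_edges_first_color:
  assumes "2 \<le> t" "1 \<le> s" "n = critical_order t s"
  shows "real n ^ 2 \<le> 8 * card (critical_edges (Suc s) n (extremal_coloring t s) 1)"
proof -
  have "card (nsets {s..<n} 2) \<le> card (critical_edges (Suc s) n (extremal_coloring t s) 1)"
    using critical_edges_first_color[OF assms(1,2)] assms(3)
    by (intro card_mono) (auto simp: critical_edges_def finite_K_edges)
  moreover have "card (nsets {s..<n} 2) = (t * s + 1) choose 2"
    using assms by (simp add: card_nsets)
  moreover have "2 * ((t * s + 1) choose 2) = (t * s + 1) * (t * s)"
    using twice_choose_two[of "t * s + 1"] by simp
  ultimately have "(t * s) * (t * s) \<le> 2 * card (critical_edges (Suc s) n (extremal_coloring t s) 1)"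
    by (simp add: algebra_simps)
  moreover have "2 * s \<le> t * s"
    using assms(1) by (rule mult_le_mono1)
  then have "n \<le> 2 * (t * s)"
    using assms(2) unfolding assms(3) add_mult_distrib by linarith
  then have "n ^ 2 \<le> (2 * (t * s)) ^ 2"
    by (rule power_mono) simp
  ultimately have "n ^ 2 \<le> 8 * card (critical_edges (Suc s) n (extremal_coloring t s) 1)"
    by (simp add: power2_eq_square)
  then show ?thesis
    by (metis of_nat_le_iff of_nat_mult of_nat_numeral of_nat_power)
qed

text \<open>As \<open>n \<ge> 3 s + 1\<close>, the last block contains at most half of all edges; with \<open>n - 1 \<ge> n / 2\<close>
  this leaves at least \<open>n\<^sup>2 / 8\<close> others.\<close>

lemma card_critical_edges_last_color:
  assumes "2 \<le> t" "1 \<le> s" "n = critical_order t s"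
  shows "real n ^ 2 \<le> 8 * card (critical_edges (Suc s) n (extremal_coloring t s) t)"
proof -
  define A where "A = {(t - 1) * s..<n}"
  have cA: "card A = 2 * s + 1"
    using assms by (cases t) (auto simp: A_def algebra_simps)
  have "K_edges n - nsets A 2 \<subseteq> critical_edges (Suc s) n (extremal_coloring t s) t"
  proof
    fix e assume e: "e \<in> K_edges n - nsets A 2"
    then have "\<not> e \<subseteq> A"
      by (auto simp: K_edges_def nsets_def)
    then show "e \<in> critical_edges (Suc s) n (extremal_coloring t s) t"
      using critical_edges_last_color[of t s e] e assms by (auto simp: A_def)
  qed
  then have "card (K_edges n - nsets A 2) \<le> card (critical_edges (Suc s) n (extremal_coloring t s) t)"
    by (intro card_mono) (auto simp: critical_edges_def finite_K_edges)
  moreover have "nsets A 2 \<subseteq> K_edges n"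
    by (auto simp: A_def K_edges_def nsets_def)
  then have "card (K_edges n - nsets A 2) = (n choose 2) - ((2 * s + 1) choose 2)"
    using finite_subset[OF _ finite_K_edges] cA
    by (simp add: card_Diff_subset card_K_edges card_nsets)
  moreover have "2 * (n choose 2) = n * (n - 1)" "2 * ((2 * s + 1) choose 2) = (2 * s + 1) * (2 * s)"
    using twice_choose_two[of n] twice_choose_two[of "2 * s + 1"] by simp_all
  ultimately have edges: "n * (n - 1) \<le>
      2 * card (critical_edges (Suc s) n (extremal_coloring t s) t) + (2 * s + 1) * (2 * s)"
    by linarith
  have "3 * s \<le> (t + 1) * s"
    using assms(1) by (intro mult_le_mono1) simp
  then obtain d where "n = 3 * s + 1 + d"
    using assms(3) by (metis add.assoc add.commute le_iff_add)
  moreover obtain q where "s = Suc q"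
    using assms(2) by (cases s) auto
  \<comment> \<open>Substituting \<open>n\<close> and \<open>s\<close> makes all coefficients nonnegative, so that comparing them suffices.\<close>
  ultimately have "n ^ 2 + 4 * ((2 * s + 1) * (2 * s)) \<le> 4 * (n * (n - 1))"
    by (simp add: power2_eq_square algebra_simps)
  then have "n ^ 2 \<le> 8 * card (critical_edges (Suc s) n (extremal_coloring t s) t)"
    using edges by linarith
  then show ?thesis
    by (metis of_nat_le_iff of_nat_mult of_nat_numeral of_nat_power)
qed

section \<open>Positions reached during a game\<close>

abbreviation queried :: "history \<Rightarrow> nat set set" where
  "queried h \<equiv> fst ` set h"

lemma length_play: "length (play S \<chi> k) = k"
  by (induction k) (auto simp: Let_def)

lemma set_play: "set (play S \<chi> k) = (\<lambda>j. (S (play S \<chi> j), \<chi> (S (play S \<chi> j)))) ` {..<k}"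
  by (induction k) (auto simp: Let_def lessThan_Suc)

lemma queried_play: "queried (play S \<chi> k) = (\<lambda>j. S (play S \<chi> j)) ` {..<k}"
  by (simp add: set_play image_image)

lemma card_queried_play: "card (queried (play S \<chi> k)) \<le> k"
  unfolding queried_play by (metis card_image_le card_lessThan finite_lessThan)

text \<open>Builder cannot distinguish colorings that agree on the queried edges. This is what allows an invalid
  coloring to drive the cornering game: Painter's valid coloring differs from it on a hidden
  edge only.\<close>

lemma play_cong:
  assumes "\<And>e. e \<in> queried (play S \<chi> l) \<Longrightarrow> \<chi>' e = \<chi> e" "k \<le> l"
  shows "play S \<chi>' k = play S \<chi> k"
  using assms(2)
proof (induction k)
  case (Suc k)
  then have "S (play S \<chi> k) \<in> queried (play S \<chi> l)"
    unfolding queried_play by auto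
  then show ?case
    using Suc assms(1) by (simp add: Let_def)
qed simp

lemma exposed_play: "exposed (play S \<chi> k) i = {e \<in> queried (play S \<chi> k). \<chi> e = i}"
  by (auto simp: exposed_def set_play image_image)

lemma compatible_play_iff:
  assumes "\<chi> \<in> colorings t n" "queried (play S \<chi> k) \<subseteq> K_edges n"
  shows "compatible t n (play S \<chi> k) \<chi>' \<longleftrightarrow> (\<forall>e\<in>queried (play S \<chi> k). \<chi>' e = \<chi> e)"
proof
  assume comp: "compatible t n (play S \<chi> k) \<chi>'"
  show "\<forall>e\<in>queried (play S \<chi> k). \<chi>' e = \<chi> e"
  proof
    fix e assume e: "e \<in> queried (play S \<chi> k)"
    then have "\<chi> e \<in> {1..t}"
      using assms unfolding colorings_def by blast
    moreover have "e \<in> exposed (play S \<chi> k) (\<chi> e)"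
      unfolding exposed_play using e by simp
    ultimately have "e \<in> color_class n \<chi>' (\<chi> e)"
      using comp unfolding compatible_def by blast
    then show "\<chi>' e = \<chi> e"
      by (simp add: color_class_def)
  qed
next
  assume "\<forall>e\<in>queried (play S \<chi> k). \<chi>' e = \<chi> e"
  then show "compatible t n (play S \<chi> k) \<chi>'"
    using assms(2) unfolding compatible_def exposed_play color_class_def by blast
qed

lemma exposed_play_subset:
  assumes "queried (play S \<chi> k) \<subseteq> K_edges n"
  shows "exposed (play S \<chi> k) i \<subseteq> color_class n \<chi> i"
  using assms unfolding exposed_play color_class_def by blast

lemma ex_unqueried:
  assumes "l < card F"
  shows "\<exists>e\<in>F. e \<notin> queried (play S \<chi> l)"
proof (rule ccontr)
  assume "\<not> ?thesis"
  then have "card F \<le> card (queried (play S \<chi> l))"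
    by (intro card_mono) auto
  then show False
    using card_queried_play[of S \<chi> l] assms by simp
qed

lemma ex_exhaustive_strategy:
  "\<exists>S. \<forall>\<chi>. queried (play S \<chi> (n choose 2)) = K_edges n"
proof -
  obtain es where es: "set es = K_edges n" "distinct es"
    using finite_distinct_list[OF finite_K_edges] by blast
  then have len: "length es = n choose 2"
    using distinct_card card_K_edges by metis
  have "queried (play (\<lambda>h. es ! length h) \<chi> (n choose 2)) = K_edges n" for \<chi>
    unfolding queried_play length_play using es(1) len by (auto simp: set_conv_nth)
  then show ?thesis
    by blast
qed

text \<open>Querying every edge wins any game in which full knowledge of the coloring is a winning position. It
  gives the upper bound for the locating number, and shows that the minimum defining the cornering
  number is taken over a nonempty set.\<close>

lemma exhaustive_strategy_wins:
  assumes "allowed \<subseteq> colorings t n"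
    and won: "\<And>\<chi> h. \<chi> \<in> allowed \<Longrightarrow> exposed h = color_class n \<chi> \<Longrightarrow>
        \<forall>\<chi>'. compatible t n h \<chi>' \<longrightarrow> color_class n \<chi>' = color_class n \<chi> \<Longrightarrow> won h"
  shows "\<exists>S. guarantees_win n allowed won (n choose 2) S"
proof -
  obtain S where S: "\<And>\<chi>. queried (play S \<chi> (n choose 2)) = K_edges n"
    using ex_exhaustive_strategy by blast
  have "won (play S \<chi> (n choose 2))" if "\<chi> \<in> allowed" for \<chi>
  proof (rule won[OF that])
    show "exposed (play S \<chi> (n choose 2)) = color_class n \<chi>"
    proof (intro ext equalityI)
      fix i
      show "exposed (play S \<chi> (n choose 2)) i \<subseteq> color_class n \<chi> i"
        using exposed_play_subset S by blast
      show "color_class n \<chi> i \<subseteq> exposed (play S \<chi> (n choose 2)) i"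
        unfolding exposed_play S color_class_def by simp
    qed
    show "\<forall>\<chi>'. compatible t n (play S \<chi> (n choose 2)) \<chi>' \<longrightarrow> color_class n \<chi>' = color_class n \<chi>"
    proof (intro allI impI ext)
      fix \<chi>' i assume "compatible t n (play S \<chi> (n choose 2)) \<chi>'"
      then have "\<forall>e\<in>K_edges n. \<chi>' e = \<chi> e"
        using compatible_play_iff[of \<chi> t n S "n choose 2" \<chi>'] S assms(1) \<open>\<chi> \<in> allowed\<close> by auto
      then show "color_class n \<chi>' i = color_class n \<chi> i"
        by (auto simp: color_class_def)
    qed
  qed
  moreover have "S (play S \<chi> j) \<in> K_edges n" if "j < n choose 2" for \<chi> j
    using S[of \<chi>] that unfolding queried_play by blast
  ultimately have "guarantees_win n allowed won (n choose 2) S"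
    unfolding guarantees_win_def by blast
  then show ?thesis
    by blast
qed

text \<open>All colors other than the new one only lose edges, so the new color is the only one in which a large
  matching can appear.\<close>

lemma critical_recoloring:
  assumes "\<chi> \<in> colorings t n" "\<not> has_mono_matching t r n \<chi>"
    and "j \<in> {1..t}" "e \<in> critical_edges r n \<chi> j"
  shows "\<chi>(e := j) \<in> valid_colorings t r n"
    and "\<And>i. i \<in> {1..t} \<Longrightarrow> contains_matching r (color_class n (\<chi>(e := j)) i) \<Longrightarrow> i = j"
proof -
  show "\<chi>(e := j) \<in> valid_colorings t r n"
    using assms unfolding valid_colorings_def colorings_def has_mono_matching_def critical_edges_def
    by auto
  fix i assume i: "i \<in> {1..t}" "contains_matching r (color_class n (\<chi>(e := j)) i)"
  show "i = j"
  proof (rule ccontr)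
    assume "i \<noteq> j"
    then have "color_class n (\<chi>(e := j)) i \<subseteq> color_class n \<chi> i"
      by (auto simp: color_class_def)
    then show False
      using contains_matching_mono[OF i(2)] i(1) assms(2) unfolding has_mono_matching_def by blast
  qed
qed

section \<open>The two games\<close>

lemma locating_won_if_determined:
  assumes "exposed h = color_class n \<chi>"
    and "\<forall>\<chi>'. compatible t n h \<chi>' \<longrightarrow> color_class n \<chi>' = color_class n \<chi>"
  shows "locating_won t r n h"
proof (cases "has_mono_matching t r n \<chi>")
  case True
  then show ?thesis
    unfolding locating_won_def has_mono_matching_def assms(1) by blast
next
  case False
  have "\<not> has_mono_matching t r n \<chi>'" if "compatible t n h \<chi>'" for \<chi>'
  proof -
    have "color_class n \<chi>' = color_class n \<chi>"
      using assms(2) that by blast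
    then show ?thesis
      using False by (simp add: has_mono_matching_def)
  qed
  then show ?thesis
    unfolding locating_won_def by blast
qed

text \<open>Let Painter hide \<open>\<chi>\<close>. As long as an edge \<open>e\<close> is not exposed, no large matching is exposed
  because \<open>\<chi>\<close> has none, but recoloring \<open>e\<close> shows that one is still possible.\<close>

lemma locating_number_eq:
  assumes \<chi>: "\<chi> \<in> colorings t n" "\<not> has_mono_matching t r n \<chi>"
    and crit: "\<And>e. e \<in> K_edges n \<Longrightarrow> \<exists>j\<in>{1..t}. e \<in> critical_edges r n \<chi> j"
  shows "locating_number t r n = n choose 2"
  unfolding locating_number_def
proof (rule Least_equality)
  show "\<exists>S. guarantees_win n (colorings t n) (locating_won t r n) (n choose 2) S"
    by (rule exhaustive_strategy_wins[OF order_refl]) (rule locating_won_if_determined)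
next
  fix l assume "\<exists>S. guarantees_win n (colorings t n) (locating_won t r n) l S"
  then obtain S where "guarantees_win n (colorings t n) (locating_won t r n) l S" ..
  then obtain k where k: "k \<le> l" "\<forall>j<k. S (play S \<chi> j) \<in> K_edges n"
    and won: "locating_won t r n (play S \<chi> k)"
    using \<chi>(1) unfolding guarantees_win_def by blast
  have K: "queried (play S \<chi> k) \<subseteq> K_edges n"
    unfolding queried_play using k(2) by auto
  show "n choose 2 \<le> l"
  proof (rule ccontr)
    assume "\<not> n choose 2 \<le> l"
    then have "k < card (K_edges n)"
      using k(1) by (simp add: card_K_edges)
    from ex_unqueried[OF this, of S \<chi>]
    obtain e where e: "e \<in> K_edges n" "e \<notin> queried (play S \<chi> k)"
      by blast
    obtain j where j: "j \<in> {1..t}" "e \<in> critical_edges r n \<chi> j"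
      using crit[OF e(1)] by blast
    have valid: "\<chi>(e := j) \<in> colorings t n" "has_mono_matching t r n (\<chi>(e := j))"
      using critical_recoloring(1)[OF \<chi> j] by (auto simp: valid_colorings_def)
    have "compatible t n (play S \<chi> k) (\<chi>(e := j))"
      using compatible_play_iff[OF \<chi>(1) K] e(2) by auto
    moreover have "\<not> contains_matching r (exposed (play S \<chi> k) i)" if "i \<in> {1..t}" for i
      using contains_matching_mono[OF _ exposed_play_subset[OF K]] \<chi>(2) that
      unfolding has_mono_matching_def by blast
    ultimately show False
      using won valid unfolding locating_won_def by blast
  qed
qed

lemma cornering_won_if_determined:
  assumes "\<chi> \<in> valid_colorings t r n"
    and "\<forall>\<chi>'. compatible t n h \<chi>' \<longrightarrow> color_class n \<chi>' = color_class n \<chi>"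
  shows "cornering_won t r n h"
proof -
  obtain c where c: "c \<in> {1..t}" "contains_matching r (color_class n \<chi> c)"
    using assms(1) unfolding valid_colorings_def has_mono_matching_def by blast
  have "contains_matching r (color_class n \<chi>' c)" if "compatible t n h \<chi>'" for \<chi>'
  proof -
    have "color_class n \<chi>' = color_class n \<chi>"
      using assms(2) that by blast
    then show ?thesis
      using c(2) by simp
  qed
  then show ?thesis
    unfolding cornering_won_def using c(1) by blast
qed

text \<open>With fewer than \<open>m\<close> queries against \<open>\<chi>\<close>, some edge \<open>e\<close> critical for \<open>i\<close> and some edge \<open>f\<close>
  critical for \<open>j\<close> stay hidden. Painter uses the valid coloring \<open>\<chi>(e := i)\<close>, for which the game runs
  as for \<open>\<chi>\<close>. In the end \<open>\<chi>(e := i)\<close> and \<open>\<chi>(f := j)\<close> are both possible, and they force different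
  colors.\<close>

lemma cornering_number_ge:
  assumes \<chi>: "\<chi> \<in> colorings t n" "\<not> has_mono_matching t r n \<chi>"
    and ij: "i \<in> {1..t}" "j \<in> {1..t}" "i \<noteq> j"
    and m: "m \<le> card (critical_edges r n \<chi> i)" "m \<le> card (critical_edges r n \<chi> j)"
  shows "m \<le> cornering_number t r n"
proof (rule ccontr)
  define l where "l = cornering_number t r n"
  assume "\<not> m \<le> cornering_number t r n"
  then have l: "l < card (critical_edges r n \<chi> i)" "l < card (critical_edges r n \<chi> j)"
    using m unfolding l_def by linarith+
  have "\<exists>S. guarantees_win n (valid_colorings t r n) (cornering_won t r n) (n choose 2) S"
    by (rule exhaustive_strategy_wins[of _ t])
      (auto simp: valid_colorings_def intro: cornering_won_if_determined)
  then have "\<exists>S. guarantees_win n (valid_colorings t r n) (cornering_won t r n) l S"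
    unfolding l_def cornering_number_def
    by (rule LeastI[of "\<lambda>l. \<exists>S. guarantees_win n (valid_colorings t r n) (cornering_won t r n) l S"])
  then obtain S where S: "guarantees_win n (valid_colorings t r n) (cornering_won t r n) l S" ..
  obtain e where e: "e \<in> critical_edges r n \<chi> i" "e \<notin> queried (play S \<chi> l)"
    using ex_unqueried[OF l(1), of S \<chi>] by blast
  obtain f where f: "f \<in> critical_edges r n \<chi> j" "f \<notin> queried (play S \<chi> l)"
    using ex_unqueried[OF l(2), of S \<chi>] by blast
  note E = critical_recoloring[OF \<chi> ij(1) e(1)] and F = critical_recoloring[OF \<chi> ij(2) f(1)]
  have same: "play S (\<chi>(e := i)) k = play S \<chi> k" if "k \<le> l" for k
    using e(2) by (intro play_cong[OF _ that]) auto
  obtain k where k: "k \<le> l" "\<forall>j<k. S (play S (\<chi>(e := i)) j) \<in> K_edges n"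
    and "cornering_won t r n (play S (\<chi>(e := i)) k)"
    using S E(1) unfolding guarantees_win_def by blast
  then have won: "cornering_won t r n (play S \<chi> k)"
    using same by simp
  have K: "queried (play S \<chi> k) \<subseteq> K_edges n"
    unfolding queried_play using k same by auto
  have "queried (play S \<chi> k) \<subseteq> queried (play S \<chi> l)"
    unfolding queried_play using k(1) by auto
  then have "compatible t n (play S \<chi> k) (\<chi>(e := i))" "compatible t n (play S \<chi> k) (\<chi>(f := j))"
    using compatible_play_iff[OF \<chi>(1) K] e(2) f(2) by auto
  then obtain c where "c \<in> {1..t}" "contains_matching r (color_class n (\<chi>(e := i)) c)"
      "contains_matching r (color_class n (\<chi>(f := j)) c)"
    using won E(1) F(1) unfolding cornering_won_def by blast
  then show False
    using E(2) F(2) ij(3) by blast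
qed

theorem theorem1:
  shows "(\<forall>t r n :: nat. t \<ge> 2 \<longrightarrow> r \<ge> 2 \<longrightarrow> n = matching_Ramsey t r - 1 \<longrightarrow>
            locating_number t r n = n choose 2) \<and>
         (\<exists>c::real. c > 0 \<and>
            (\<forall>t r n :: nat. t \<ge> 2 \<longrightarrow> r \<ge> 2 \<longrightarrow> n = matching_Ramsey t r - 1 \<longrightarrow>
               real (cornering_number t r n) \<ge> c * (real n)\<^sup>2))"
proof -
  have both: "locating_number t r n = n choose 2 \<and>
      1 / 8 * (real n)\<^sup>2 \<le> real (cornering_number t r n)"
    if "2 \<le> t" "2 \<le> r" "n = matching_Ramsey t r - 1" for t r n :: nat
  proof -
    obtain s where s: "r = Suc s" "1 \<le> s"
      using \<open>2 \<le> r\<close> by (cases r) auto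
    have n: "n = critical_order t s"
      using that matching_Ramsey_eq[of t s] s by simp
    let ?\<chi> = "extremal_coloring t s"
    have \<chi>: "?\<chi> \<in> colorings t n" "\<not> has_mono_matching t r n ?\<chi>"
      using extremal_coloring_in_colorings[of t s n] \<open>2 \<le> t\<close>
        extremal_coloring_no_mono_matching[OF s(2), of n t] n s(1) by simp_all
    have "locating_number t r n = n choose 2"
      using every_edge_critical[OF \<open>2 \<le> t\<close> s(2)] n s(1) by (intro locating_number_eq[OF \<chi>]) auto
    moreover have
      "min (card (critical_edges r n ?\<chi> 1)) (card (critical_edges r n ?\<chi> t)) \<le> cornering_number t r n"
      using \<open>2 \<le> t\<close> by (intro cornering_number_ge[OF \<chi>, of 1 t]) auto
    then have "real n ^ 2 \<le> 8 * cornering_number t r n"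
      using card_critical_edges_first_color[OF \<open>2 \<le> t\<close> s(2) n, folded s(1)]
        card_critical_edges_last_color[OF \<open>2 \<le> t\<close> s(2) n, folded s(1)]
      unfolding min_def by (auto split: if_splits)
    ultimately show ?thesis
      by simp
  qed
  show ?thesis
  proof (intro conjI exI[of _ "1 / 8 :: real"] allI impI)
    show "locating_number t r n = n choose 2"
      if "2 \<le> t" "2 \<le> r" "n = matching_Ramsey t r - 1" for t r n
      using both[OF that] by blast
    show "1 / 8 * (real n)\<^sup>2 \<le> real (cornering_number t r n)"
      if "2 \<le> t" "2 \<le> r" "n = matching_Ramsey t r - 1" for t r n
      using both[OF that] by blast
  qed simp
qed

end
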